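(* Let $\kappa\in\{1,2,3,\dots\}$ and let $q$ be a complex number with $0<|q|<1$; put $p=q^{-1}$. Then the following three series converge and are equal: \[ \sum_{n=0}^\infty q^n(q;q^\kappa)_n=\sum_{n=0}^\infty (-1)^n \frac{q^{n(\kappa n+4-\kappa)/2}}{(q; q^\kappa)_{n+1}}=-\sum_{n=0}^\infty \frac{p^{(\kappa-1) n+1}}{(p; p^\kappa)_{n+1}}. \]
   Context: The $q$-Pochhammer symbol is defined by $(\alpha;q)_0=1$ and $(\alpha;q)_n=(\alpha;q)_{n-1}(1-\alpha q^{n-1})$ for $n\ge1$; thus $(q;q^\kappa)_n=(1-q)(1-q^{1+\kappa})\cdots(1-q^{1+(n-1)\kappa})$. *)

theory Defs imports Complex_Main begin

primrec qpoch :: "'a::comm_ring_1 \<Rightarrow> 'a \<Rightarrow> nat \<Rightarrow> 'a" where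
  "qpoch a q 0 = 1"
| "qpoch a q (Suc n) = qpoch a q n * (1 - a * q ^ n)"

end

theory Submission imports Defs begin

text \<open>The series \<open>F(z) = \<Sum>n. z\<^sup>n (a;Q)\<^sub>n\<close> satisfies \<open>(1 - z) F(z) = 1 - a z F(Q z)\<close>.
  Iterating this \<open>N\<close> times yields the first \<open>N\<close> terms of the second series (with \<open>a = z = q\<close> and
  \<open>Q = q\<^sup>\<kappa>\<close>) plus a remainder which decays superexponentially.  The third series agrees with
  the second one term by term, because \<open>1 - p\<^sup>m = - p\<^sup>m (1 - q\<^sup>m)\<close>.\<close>

text \<open>The ratio enters as a multiplier \<open>r n\<close> rather than as a quotient, so that
  terms of \<open>f\<close> may vanish, as \<open>qpoch a Q n\<close> does for large
  \<open>n\<close> when some \<open>a * Q ^ j\<close> equals 1.\<close>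

lemma summable_of_ratio_tendsto:
  fixes f r :: "nat \<Rightarrow> 'a::{real_normed_field,banach}"
  assumes "\<And>n. f (Suc n) = r n * f n" and "r \<longlonglongrightarrow> l" and "norm l < 1"
  shows "summable (\<lambda>n. norm (f n))"
proof -
  obtain c where c: "norm l < c" "c < 1"
    using dense assms(3) by blast
  have "\<forall>\<^sub>F n in sequentially. norm (r n) < c"
    using tendsto_norm[OF assms(2)] c(1) by (rule order_tendstoD)
  then obtain N where N: "\<And>n. n \<ge> N \<Longrightarrow> norm (r n) < c"
    by (auto simp: eventually_sequentially)
  show ?thesis
  proof (rule summable_ratio_test[OF c(2)])
    fix n assume "n \<ge> N"
    then show "norm (norm (f (Suc n))) \<le> c * norm (norm (f n))"
      using N[of n] by (simp add: assms(1) norm_mult mult_right_mono)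
  qed
qed

lemma mult_power_neq_1:
  fixes z Q :: "'a::real_normed_field"
  assumes "norm z < 1" and "norm Q < 1"
  shows "z * Q ^ n \<noteq> 1"
proof
  assume "z * Q ^ n = 1"
  then have "norm z * norm Q ^ n = 1"
    by (metis norm_mult norm_one norm_power)
  moreover have "norm z * norm Q ^ n \<le> norm z"
    using assms by (simp add: mult_left_le power_le_one)
  ultimately show False
    using assms by simp
qed

lemma qpoch_neq_0:
  fixes z Q :: "'a::real_normed_field"
  assumes "norm z < 1" and "norm Q < 1"
  shows "qpoch z Q n \<noteq> 0"
  by (induction n) (simp_all add: mult_power_neq_1[OF assms])

lemma summable_norm_power_qpoch:
  fixes z a Q :: "'a::{real_normed_field,banach}"
  assumes "norm z < 1" and "norm Q < 1"
  shows "summable (\<lambda>n. norm (z ^ n * qpoch a Q n))"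
proof (rule summable_of_ratio_tendsto)
  show "z ^ Suc n * qpoch a Q (Suc n) = (z * (1 - a * Q ^ n)) * (z ^ n * qpoch a Q n)" for n
    by (simp add: mult_ac)
  have "(\<lambda>n. z * (1 - a * Q ^ n)) \<longlonglongrightarrow> z * (1 - a * 0)"
    by (intro tendsto_intros LIMSEQ_power_zero assms)
  then show "(\<lambda>n. z * (1 - a * Q ^ n)) \<longlonglongrightarrow> z"
    by simp
qed (fact assms)

text \<open>Split off the term at 0 and expand the last factor \<open>1 - a * Q ^ n\<close> of every
  other term: the part with 1 gives \<open>z\<close> times the same series, and the part with
  \<open>Q ^ n\<close> turns \<open>z ^ n\<close> into \<open>(z * Q) ^ n\<close>. Since only
  \<open>z\<close> moves, it must stay independent of \<open>a\<close>, although both become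
  \<open>q\<close> in the end.\<close>

lemma suminf_power_qpoch_rec:
  fixes z a Q :: "'a::{real_normed_field,banach}"
  assumes "norm z < 1" and "norm Q < 1"
  shows "(1 - z) * (\<Sum>n. z ^ n * qpoch a Q n) = 1 - a * z * (\<Sum>n. (z * Q) ^ n * qpoch a Q n)"
proof -
  have zQ: "norm (z * Q) < 1"
    using assms by (metis mult_strict_mono' norm_ge_zero norm_mult mult_1)
  note s = summable_norm_cancel[OF summable_norm_power_qpoch[of _ Q a]]
  note s1 = s[OF assms] and s2 = s[OF zQ assms(2)]
  have "(\<Sum>n. z ^ n * qpoch a Q n) = 1 + (\<Sum>n. z ^ Suc n * qpoch a Q (Suc n))"
    using suminf_split_head[OF s1] by simp
  also have "(\<Sum>n. z ^ Suc n * qpoch a Q (Suc n)) =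
      (\<Sum>n. z * (z ^ n * qpoch a Q n) - a * z * ((z * Q) ^ n * qpoch a Q n))"
    by (simp add: algebra_simps power_mult_distrib)
  also have "\<dots> = z * (\<Sum>n. z ^ n * qpoch a Q n) - a * z * (\<Sum>n. (z * Q) ^ n * qpoch a Q n)"
    by (simp add: suminf_diff[symmetric] suminf_mult s1 s2 summable_mult)
  finally show ?thesis
    by (simp add: algebra_simps)
qed

lemma power_qpoch_transformation:
  fixes z a Q :: "'a::{real_normed_field,banach}"
  assumes "norm z < 1" and "norm Q < 1"
  shows "(\<lambda>n. (- (a * z)) ^ n * Q ^ (n choose 2) / qpoch z Q (Suc n)) sums
         (\<Sum>n. z ^ n * qpoch a Q n)"
proof -
  define F where "F w = (\<Sum>n. w ^ n * qpoch a Q n)" for w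
  \<comment> \<open>\<open>R n\<close> is the coefficient of \<open>F (z * Q ^ n)\<close> after
    \<open>n\<close> uses of the recurrence. The \<open>n\<close>-th summand of the claim is
    \<open>R n / (1 - z * Q ^ n)\<close>, which accounts for the index \<open>Suc n\<close> in its
    denominator.\<close>
  define R where "R n = (- (a * z)) ^ n * Q ^ (n choose 2) / qpoch z Q n" for n
  have le: "norm (z * Q ^ n) \<le> norm z" for n
    using assms by (simp add: norm_mult norm_power mult_left_le power_le_one)
  note nz = mult_power_neq_1[OF assms]
  have R_Suc: "R (Suc n) = - (a * z) * Q ^ n / (1 - z * Q ^ n) * R n" for n
    by (simp add: R_def numeral_2_eq_2 power_add mult_ac)
  have partial: "(\<Sum>n<N. (- (a * z)) ^ n * Q ^ (n choose 2) / qpoch z Q (Suc n)) =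
      F z - R N * F (z * Q ^ N)" for N
  proof (induction N)
    case 0
    show ?case by (simp add: R_def numeral_2_eq_2)
  next
    case (Suc N)
    have "(1 - z * Q ^ N) * F (z * Q ^ N) = 1 - a * (z * Q ^ N) * F (z * Q ^ Suc N)"
      unfolding F_def using suminf_power_qpoch_rec[of "z * Q ^ N" Q a] le[of N] assms
      by (simp add: mult_ac)
    then have "F (z * Q ^ N) = (1 - a * (z * Q ^ N) * F (z * Q ^ Suc N)) / (1 - z * Q ^ N)"
      using nz[of N] by (simp add: field_simps)
    then have "R N * F (z * Q ^ N) = R N / (1 - z * Q ^ N) + R (Suc N) * F (z * Q ^ Suc N)"
      unfolding R_Suc by (simp only:) (simp add: diff_divide_distrib right_diff_distrib mult_ac)
    then show ?case
      using Suc.IH by (simp add: R_def)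
  qed
  \<comment> \<open>The ratio of consecutive \<open>R n\<close> tends to 0 for every
    \<open>a\<close>, because of the factor \<open>Q ^ n\<close>.\<close>
  have "(\<lambda>n. - (a * z) * Q ^ n / (1 - z * Q ^ n)) \<longlonglongrightarrow> - (a * z) * 0 / (1 - z * 0)"
    by (intro tendsto_intros LIMSEQ_power_zero assms) simp
  then have "summable (\<lambda>n. norm (R n))"
    using summable_of_ratio_tendsto[of R, OF R_Suc, of 0] by simp
  then have R0: "R \<longlonglongrightarrow> 0"
    using summable_LIMSEQ_zero tendsto_norm_zero_iff by blast
  \<comment> \<open>As |z Q^N| \<le> |z|, the absolute series at \<open>z\<close> dominates termwise
    and bounds \<open>F (z * Q ^ N)\<close> uniformly in \<open>N\<close>; with \<open>R N\<close>
    tending to 0, this kills the remainder.\<close>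
  have "norm (F (z * Q ^ N)) \<le> (\<Sum>n. norm (z ^ n * qpoch a Q n))" for N
    unfolding F_def
    by (intro norm_suminf_le summable_norm_power_qpoch assms)
      (simp only: norm_mult[of _ "qpoch _ _ _"] norm_power, intro mult_right_mono power_mono le; simp)
  then have "Bseq (\<lambda>N. F (z * Q ^ N))"
    by (rule BseqI')
  then have "(\<lambda>N. R N * F (z * Q ^ N)) \<longlonglongrightarrow> 0"
    using bounded_bilinear.Zfun_prod_Bfun[OF bounded_bilinear_mult] R0
    unfolding tendsto_Zfun_iff diff_0_right by blast
  then have "(\<lambda>N. F z - R N * F (z * Q ^ N)) \<longlonglongrightarrow> F z - 0"
    by (intro tendsto_intros)
  then show ?thesis
    unfolding sums_def partial by (simp add: F_def)
qed

text \<open>Each factor satisfies (1 - q^(-m)) q^m = -(1 - q^m) with m = 1 + k j. Summing these m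
  over j < n gives the exponent \<open>n + k * (n choose 2)\<close>.\<close>

lemma qpoch_inverse:
  fixes q :: "'a::field"
  assumes "q \<noteq> 0"
  shows "qpoch (inverse q) (inverse q ^ k) n * q ^ (n + k * (n choose 2)) =
         (- 1) ^ n * qpoch q (q ^ k) n"
proof (induction n)
  case (Suc n)
  have *: "(1 - inverse q * (inverse q ^ k) ^ n) * q ^ Suc (k * n) = - (1 - q * (q ^ k) ^ n)"
    using assms by (simp add: field_simps power_mult)
  have "q ^ (Suc n + k * (Suc n choose 2)) = q ^ (n + k * (n choose 2)) * q ^ Suc (k * n)"
    by (simp add: numeral_2_eq_2 algebra_simps flip: power_add)
  then have "qpoch (inverse q) (inverse q ^ k) (Suc n) * q ^ (Suc n + k * (Suc n choose 2)) =
      (qpoch (inverse q) (inverse q ^ k) n * q ^ (n + k * (n choose 2))) *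
      ((1 - inverse q * (inverse q ^ k) ^ n) * q ^ Suc (k * n))"
    by (simp only: qpoch.simps mult_ac)
  also have "\<dots> = (-1) ^ n * qpoch q (q ^ k) n * - (1 - q * (q ^ k) ^ n)"
    by (simp only: Suc.IH *)
  also have "\<dots> = (-1) ^ Suc n * qpoch q (q ^ k) (Suc n)"
    by (simp only: qpoch.simps power_Suc mult_minus_left mult_minus_right mult_1_left mult.assoc)
  finally show ?case .
qed (simp add: numeral_2_eq_2)

theorem theorem2:
  fixes \<kappa> :: nat and q p :: complex
  assumes "\<kappa> \<ge> 1" and "0 < norm q" and "norm q < 1" and "p = inverse q"
  shows "summable (\<lambda>n. q ^ n * qpoch q (q ^ \<kappa>) n) \<and>
    summable (\<lambda>n. (-1) ^ n *
           (q powi ((int n * (int \<kappa> * int n + 4 - int \<kappa>)) div 2) / qpoch q (q ^ \<kappa>) (n + 1))) \<and>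
    summable (\<lambda>n. p ^ ((\<kappa> - 1) * n + 1) / qpoch p (p ^ \<kappa>) (n + 1)) \<and>
    (\<Sum>n. q ^ n * qpoch q (q ^ \<kappa>) n) =
         (\<Sum>n. (-1) ^ n *
           (q powi ((int n * (int \<kappa> * int n + 4 - int \<kappa>)) div 2) / qpoch q (q ^ \<kappa>) (n + 1))) \<and>
    (\<Sum>n. (-1) ^ n *
           (q powi ((int n * (int \<kappa> * int n + 4 - int \<kappa>)) div 2) / qpoch q (q ^ \<kappa>) (n + 1))) =
         - (\<Sum>n. p ^ ((\<kappa> - 1) * n + 1) / qpoch p (p ^ \<kappa>) (n + 1))"
proof -
  have q0: "q \<noteq> 0" and q\<kappa>: "norm (q ^ \<kappa>) < 1"
    using assms by (auto simp: norm_power power_less_one_iff)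
  define t where "t n = (- (q * q)) ^ n * (q ^ \<kappa>) ^ (n choose 2) / qpoch q (q ^ \<kappa>) (Suc n)" for n
  have t: "t sums (\<Sum>n. q ^ n * qpoch q (q ^ \<kappa>) n)"
    unfolding t_def by (rule power_qpoch_transformation[OF assms(3) q\<kappa>])
  have t_power: "t n = (-1) ^ n * (q ^ (2 * n + \<kappa> * (n choose 2)) / qpoch q (q ^ \<kappa>) (n + 1))" for n
  proof -
    have "(- (q * q)) ^ n = (-1) ^ n * q ^ (2 * n)"
      by (metis mult_minus1 power2_eq_square power_mult power_mult_distrib)
    then show ?thesis
      by (simp add: t_def power_add power_mult)
  qed
  have second: "(-1) ^ n * (q powi ((int n * (int \<kappa> * int n + 4 - int \<kappa>)) div 2) /
      qpoch q (q ^ \<kappa>) (n + 1)) = t n" for n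
  proof -
    \<comment> \<open>The factor 4 - \<kappa> may be negative, hence the integers. The product is
      nevertheless twice a natural number, so \<open>div 2\<close> is exact and \<open>powi\<close>
      reduces to an ordinary power.\<close>
    have "2 * int (n choose 2) = int n * (int n - 1)"
      by (induction n) (simp_all add: numeral_2_eq_2 algebra_simps)
    then have "int n * (int \<kappa> * int n + 4 - int \<kappa>) =
        int \<kappa> * (2 * int (n choose 2)) + 4 * int n"
      by (simp only:) (simp add: algebra_simps)
    then have "int n * (int \<kappa> * int n + 4 - int \<kappa>) = 2 * int (2 * n + \<kappa> * (n choose 2))"
      by (simp add: algebra_simps)
    then have "(int n * (int \<kappa> * int n + 4 - int \<kappa>)) div 2 = int (2 * n + \<kappa> * (n choose 2))"
      by simp
    then show ?thesis
      unfolding t_power by (simp only: power_int_of_nat)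
  qed
  have third: "p ^ ((\<kappa> - 1) * n + 1) / qpoch p (p ^ \<kappa>) (n + 1) = - t n" for n
  proof -
    \<comment> \<open>\<open>e\<close> is the power of \<open>q\<close> that clears the inverse
      powers in \<open>qpoch p (p ^ \<kappa>) (n + 1)\<close>; numerator and denominator are both
      multiplied by \<open>q ^ e\<close>.\<close>
    define e where "e = Suc n + \<kappa> * (Suc n choose 2)"
    \<comment> \<open>The subtraction is on naturals, and \<kappa> \<ge> 1 keeps it from
      truncating.\<close>
    have "\<kappa> * n = (\<kappa> - 1) * n + n"
      using assms(1) by (cases \<kappa>) auto
    then have "e = (2 * n + \<kappa> * (n choose 2)) + ((\<kappa> - 1) * n + 1)"
      by (simp add: e_def numeral_2_eq_2 algebra_simps)
    then have "p ^ ((\<kappa> - 1) * n + 1) * q ^ e = q ^ (2 * n + \<kappa> * (n choose 2))"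
      using q0 by (simp add: assms(4) power_add field_simps)
    moreover have "qpoch p (p ^ \<kappa>) (n + 1) * q ^ e = (-1) ^ (n + 1) * qpoch q (q ^ \<kappa>) (n + 1)"
      using qpoch_inverse[OF q0, of \<kappa> "Suc n"] unfolding e_def assms(4) by simp
    moreover have "p ^ ((\<kappa> - 1) * n + 1) / qpoch p (p ^ \<kappa>) (n + 1) =
        (p ^ ((\<kappa> - 1) * n + 1) * q ^ e) / (qpoch p (p ^ \<kappa>) (n + 1) * q ^ e)"
      using q0 by simp
    ultimately have "p ^ ((\<kappa> - 1) * n + 1) / qpoch p (p ^ \<kappa>) (n + 1) =
        q ^ (2 * n + \<kappa> * (n choose 2)) / ((-1) ^ (n + 1) * qpoch q (q ^ \<kappa>) (n + 1))"
      by simp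
    \<comment> \<open>The sign \<open>(-1) ^ (n + 1)\<close> in the denominator equals its own
      inverse, which gives the minus sign in front of \<open>t n\<close>.\<close>
    then show ?thesis
      unfolding t_power by (cases "even n") simp_all
  qed
  show ?thesis
    unfolding second third
    using t summable_norm_cancel[OF summable_norm_power_qpoch[OF assms(3) q\<kappa>]]
    by (simp add: sums_iff summable_minus suminf_minus)
qed

end
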